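(* Let $\mathcal{K}\subset\mathbb{R}^n$ be a proper convex cone whose dual cone $\mathcal{K}^*$ admits an LHSCB $f:(\mathcal{K}^* )^\circ\to\mathbb{R}$ with Hessian $H$. Let $A\in\mathbb{R}^{m\times n}$ have linearly independent rows and assume that $\{y\in\mathbb{R}^m : A^{\mathrm T}y\in(\mathcal{K}^* )^\circ\}$ is non-empty. Let $\mathcal{K}_A=\{Ax : x\in\mathcal{K}\}$, so that $\mathcal{K}_A^*=\{y\in\mathbb{R}^m : A^{\mathrm T}y\in\mathcal{K}^*\}$, and equip $\mathcal{K}_A^*$ with the LHSCB $f_A(y)=f(A^{\mathrm T}y)$. Suppose $b\in\mathcal{K}_A^\circ$, and let $y\in(\mathcal{K}_A^* )^\circ$ be a B-certificate of $b$ with respect to $f_A$. Then the vector $$x=H(A^{\mathrm T}y)A^{\mathrm T}\left(AH(A^{\mathrm T}y)A^{\mathrm T}\right)^{-1}b$$ satisfies $Ax=b$ and $x\in\mathcal{K}$.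
   Context: A proper convex cone is a closed convex cone that is pointed and has non-empty interior. $\mathcal{C}^\circ$ denotes the interior of $\mathcal{C}$. The dual of a cone $\mathcal{C}\subset\mathbb{R}^k$ is $\mathcal{C}^*=\{y\in\mathbb{R}^k : x^{\mathrm T}y\ge 0 \text{ for all } x\in\mathcal{C}\}$. A (strongly nondegenerate) self-concordant barrier (SCB) for a convex cone $\mathcal{C}$ with non-empty interior is a strictly convex, at least three times differentiable function $f:\mathcal{C}^\circ\to\mathbb{R}$ with positive definite Hessian everywhere such that, with $g$ and $H$ denoting the gradient and Hessian of $f$: (1) $f(x)\to\infty$ as $x$ tends to the boundary of $\mathcal{C}$; (2) $|D^3f(x)[h,h,h]|\le 2\,(D^2f(x)[h,h])^{3/2}$ for all $x\in\mathcal{C}^\circ$ and all directions $h$; (3) $\nu:=\sup_{x\in\mathcal{C}^\circ} g(x)^{\mathrm T}H(x)^{-1}g(x)<\infty$. It is a $\nu$-LHSCB (logarithmically homogeneous self-concordant barrier with parameter $\nu$) if in addition $f(tx)=f(x)-\nu\ln t$ for all $x\in\mathcal{C}^\circ$, $t>0$. An LHSCB is a $\nu$-LHSCB for some $\nu$. It is a known fact that, under the stated assumptions, $f_A$ is an LHSCB with domain $(\mathcal{K}_A^* )^\circ=\{y : A^{\mathrm T}y\in(\mathcal{K}^* )^\circ\}$. Denote its gradient and Hessian by $g_A$ and $H_A$ and put $B_A(y)=H_A(y)+g_A(y)g_A(y)^{\mathrm T}$. A vector $y\in(\mathcal{K}_A^* )^\circ$ is a B-certificate of $b$ with respect to $f_A$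 if $B_A(y)^{-1}b\in\mathcal{K}_A^*$. *)

theory Defs
  imports "HOL-Analysis.Analysis"
begin

section \<open>Cones\<close>

definition proper_cone :: "'a::euclidean_space set \<Rightarrow> bool" where
  "proper_cone K \<longleftrightarrow>
     convex_cone K \<and> closed K \<and> (\<forall>x. x \<in> K \<and> - x \<in> K \<longrightarrow> x = 0) \<and> interior K \<noteq> {}"

definition dual_cone :: "'a::real_inner set \<Rightarrow> 'a set" where
  "dual_cone C = {y. \<forall>x\<in>C. x \<bullet> y \<ge> 0}"

section \<open>Derivatives and matrices\<close>

definition gradient :: "(real^'n \<Rightarrow> real) \<Rightarrow> real^'n \<Rightarrow> real^'n" where
  "gradient f x = (THE g. GDERIV f x :> g)"

definition hessian :: "(real^'n \<Rightarrow> real) \<Rightarrow> real^'n \<Rightarrow> real^'n^'n" where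
  "hessian f x = jacobian (gradient f) (at x)"

definition third_derivative :: "(real^'n \<Rightarrow> real) \<Rightarrow> real^'n \<Rightarrow> real^'n \<Rightarrow> real" where
  "third_derivative f x h = h \<bullet> (frechet_derivative (hessian f) (at x) h *v h)"

definition three_times_differentiable_on :: "(real^'n \<Rightarrow> real) \<Rightarrow> (real^'n) set \<Rightarrow> bool" where
  "three_times_differentiable_on f S \<longleftrightarrow>
     (\<forall>x\<in>S. f differentiable at x \<and> gradient f differentiable at x \<and> hessian f differentiable at x)"

definition positive_definite :: "real^'n^'n \<Rightarrow> bool" where
  "positive_definite M \<longleftrightarrow> transpose M = M \<and> (\<forall>h. h \<noteq> 0 \<longrightarrow> h \<bullet> (M *v h) > 0)"

definition strictly_convex_on :: "'a::real_vector set \<Rightarrow> ('a \<Rightarrow> real) \<Rightarrow> bool" where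
  "strictly_convex_on S f \<longleftrightarrow> convex S \<and>
     (\<forall>x\<in>S. \<forall>y\<in>S. \<forall>t. x \<noteq> y \<and> 0 < t \<and> t < 1 \<longrightarrow>
        f ((1 - t) *\<^sub>R x + t *\<^sub>R y) < (1 - t) * f x + t * f y)"

(* Stated for the indexed family of rows: the set rows A would not see repeated rows. *)
definition lin_indep_rows :: "real^'n^'m \<Rightarrow> bool" where
  "lin_indep_rows A \<longleftrightarrow> (\<forall>c. (\<Sum>i\<in>UNIV. c i *s row i A) = 0 \<longrightarrow> (\<forall>i. c i = 0))"

section \<open>Self-concordant barriers\<close>

text \<open>A barrier for C is a total function; only its values on the interior of C matter.\<close>

definition newton_decrement_sq :: "(real^'n \<Rightarrow> real) \<Rightarrow> real^'n \<Rightarrow> real" where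
  "newton_decrement_sq f x = gradient f x \<bullet> (matrix_inv (hessian f x) *v gradient f x)"

definition barrier_parameter :: "(real^'n) set \<Rightarrow> (real^'n \<Rightarrow> real) \<Rightarrow> real" where
  "barrier_parameter C f = (SUP x\<in>interior C. newton_decrement_sq f x)"

definition SCB :: "(real^'n) set \<Rightarrow> (real^'n \<Rightarrow> real) \<Rightarrow> bool" where
  "SCB C f \<longleftrightarrow>
     convex_cone C \<and> interior C \<noteq> {} \<and>
     strictly_convex_on (interior C) f \<and>
     three_times_differentiable_on f (interior C) \<and>
     (\<forall>x\<in>interior C. positive_definite (hessian f x)) \<and>
     (\<forall>z\<in>frontier C. filterlim f at_top (at z within interior C)) \<and>
     (\<forall>x\<in>interior C. \<forall>h.
        \<bar>third_derivative f x h\<bar> \<le> 2 * (h \<bullet> (hessian f x *v h)) powr (3/2)) \<and>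
     bdd_above (newton_decrement_sq f ` interior C)"

definition nu_LHSCB :: "real \<Rightarrow> (real^'n) set \<Rightarrow> (real^'n \<Rightarrow> real) \<Rightarrow> bool" where
  "nu_LHSCB \<nu> C f \<longleftrightarrow> SCB C f \<and> \<nu> = barrier_parameter C f \<and>
     (\<forall>x\<in>interior C. \<forall>t>0. f (t *\<^sub>R x) = f x - \<nu> * ln t)"

definition LHSCB :: "(real^'n) set \<Rightarrow> (real^'n \<Rightarrow> real) \<Rightarrow> bool" where
  "LHSCB C f \<longleftrightarrow> (\<exists>\<nu>. nu_LHSCB \<nu> C f)"

section \<open>B-certificates\<close>

definition B_matrix :: "(real^'m \<Rightarrow> real) \<Rightarrow> real^'m \<Rightarrow> real^'m^'m" where
  "B_matrix F y =
     hessian F y + (columnvector (gradient F y) :: real^1^'m) ** rowvector (gradient F y)"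

text \<open>Here D is the cone whose interior is the domain of the barrier F.\<close>

definition B_certificate ::
    "(real^'m) set \<Rightarrow> (real^'m \<Rightarrow> real) \<Rightarrow> real^'m \<Rightarrow> real^'m \<Rightarrow> bool" where
  "B_certificate D F b y \<longleftrightarrow> y \<in> interior D \<and> matrix_inv (B_matrix F y) *v b \<in> D"

end

theory Submission
  imports Defs "HOL-Real_Asymp.Real_Asymp"
begin

text \<open>By default \<open>transpose A *v x\<close> is simplified to \<open>x v* A\<close>;
  disabling this keeps the form in which the adjoint identities below are stated.\<close>

declare transpose_matrix_vector [simp del]

text \<open>
  Put \<open>s = A\<^sup>T y\<close> and let \<open>g\<close>, \<open>H\<close> be the gradient and Hessian of \<open>f\<close> at \<open>s\<close>. Homogeneity gives
  \<open>H s = - g\<close>, from which \<open>x = (H + g g\<^sup>T) v\<close> with \<open>v = A\<^sup>T B\<^sub>A(y)\<^sup>-\<^sup>1 b\<close>, a vector of the dual cone of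
  \<open>K\<close>. It remains to see that \<open>H + g g\<^sup>T\<close> maps the dual cone into \<open>K\<close>. By Cauchy--Schwarz and the
  bipolar theorem this follows from \<open>\<parallel>u\<parallel>\<^sub>s \<le> - g \<bullet> u\<close> for \<open>u\<close> in the dual cone, where
  \<open>\<parallel>u\<parallel>\<^sub>s\<close> is the norm given by \<open>H\<close>.
\<close>

section \<open>Gradients and Hessians\<close>

lemma gradientI:
  assumes "GDERIV f x :> g"
  shows "gradient f x = g"
  unfolding gradient_def
proof (rule the_equality)
  fix g' assume "GDERIV f x :> g'"
  then have "(\<lambda>h. h \<bullet> g') = (\<lambda>h. h \<bullet> g)"
    using assms unfolding gderiv_def by (rule has_derivative_unique)
  then show "g' = g"
    by (metis vector_eq_ldot)
qed (fact assms)

lemma GDERIV_gradient: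
  assumes "f differentiable at x"
  shows "GDERIV f x :> gradient f x"
proof -
  obtain D where D: "(f has_derivative D) (at x)"
    using assms by (auto simp: differentiable_def)
  \<comment> \<open>Riesz representation: \<open>adjoint D 1\<close> is the vector representing the
    functional \<open>D\<close>.\<close>
  have "D h = h \<bullet> adjoint D 1" for h
    using adjoint_works[OF has_derivative_linear[OF D], of h 1] by simp
  then have "D = (\<lambda>h. h \<bullet> adjoint D 1)"
    by blast
  with D have "GDERIV f x :> adjoint D 1"
    unfolding gderiv_def by metis
  then show ?thesis
    by (simp add: gradientI)
qed

lemma has_derivative_gradient:
  assumes "gradient f differentiable at x"
  shows "(gradient f has_derivative (*v) (hessian f x)) (at x)"
  using assms unfolding hessian_def by (simp add: jacobian_works)

lemma hessianI:
  assumes "(gradient f has_derivative (*v) M) (at x)"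
  shows "hessian f x = M"
  using assms unfolding hessian_def jacobian_def
  by (metis frechet_derivative_at matrix_of_matrix_vector_mul)

lemma inner_transpose_mult: "x \<bullet> (transpose A *v z) = (A *v x) \<bullet> (z :: real^'m)"
  for A :: "real^'n^'m"
  by (metis dot_lmul_matrix inner_commute transpose_matrix_vector)

lemma gradient_compose_transpose:
  fixes A :: "real^'n^'m"
  assumes "f differentiable at (transpose A *v y)"
  shows "gradient (\<lambda>y. f (transpose A *v y)) y = A *v gradient f (transpose A *v y)"
proof (rule gradientI)
  have "((\<lambda>y. transpose A *v y) has_derivative (\<lambda>y. transpose A *v y)) (at y)"
    by (intro bounded_linear_imp_has_derivative matrix_vector_mul_bounded_linear)
  from has_derivative_compose[OF this GDERIV_gradient[OF assms, unfolded gderiv_def]]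
  show "GDERIV (\<lambda>y. f (transpose A *v y)) y :> A *v gradient f (transpose A *v y)"
    unfolding gderiv_def by (metis (lifting) ext inner_commute inner_transpose_mult)
qed

text \<open>The Hessian differentiates the gradient formula, so that formula must hold on a
  neighbourhood of \<open>y\<close>; the preimage of the open set \<open>S\<close> is one.\<close>

lemma hessian_compose_transpose:
  fixes A :: "real^'n^'m"
  assumes "open S" "transpose A *v y \<in> S" "\<And>x. x \<in> S \<Longrightarrow> f differentiable at x"
    and "gradient f differentiable at (transpose A *v y)"
  shows "hessian (\<lambda>y. f (transpose A *v y)) y = A ** hessian f (transpose A *v y) ** transpose A"
proof (rule hessianI)
  let ?T = "(*v) (transpose A)"
  have T: "(?T has_derivative ?T) (at y)"
    by (intro bounded_linear_imp_has_derivative matrix_vector_mul_bounded_linear)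
  have "((\<lambda>y. A *v gradient f (?T y)) has_derivative (\<lambda>h. A *v (hessian f (?T y) *v ?T h))) (at y)"
    by (intro bounded_linear.has_derivative[OF matrix_vector_mul_bounded_linear]
        has_derivative_compose[OF T has_derivative_gradient[OF assms(4)]])
  then have "((\<lambda>y. A *v gradient f (?T y)) has_derivative
      (*v) (A ** hessian f (?T y) ** transpose A)) (at y)"
    by (simp add: matrix_vector_mul_assoc matrix_mul_assoc)
  moreover have "open (?T -` S)"
    using assms(1) by (intro open_vimage matrix_vector_mult_linear_continuous_on)
  ultimately show "(gradient (\<lambda>y. f (?T y)) has_derivative
      (*v) (A ** hessian f (?T y) ** transpose A)) (at y)"
    by (rule has_derivative_transform_within_open)
      (use assms in \<open>auto simp: gradient_compose_transpose\<close>)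
qed

section \<open>Matrices\<close>

lemma B_matrix_mult:
  "B_matrix F y *v v = hessian F y *v v + (gradient F y \<bullet> v) *\<^sub>R gradient F y"
proof -
  have "(columnvector (gradient F y) :: real^1^_) ** rowvector (gradient F y) *v v
      = (gradient F y \<bullet> v) *\<^sub>R gradient F y"
    by (simp add: vec_eq_iff matrix_vector_mult_def matrix_matrix_mult_def columnvector_def
        rowvector_def inner_vec_def sum_distrib_left algebra_simps)
  then show ?thesis
    by (simp add: B_matrix_def matrix_vector_mult_add_rdistrib)
qed

text \<open>A strictly positive quadratic form forces a trivial kernel. Applied below to
  \<open>A ** H ** transpose A\<close> and to \<open>B_matrix F y\<close>.\<close>

lemma matrix_inv_of_inner_pos:
  fixes M :: "real^'n^'n"
  assumes "\<And>h. h \<noteq> 0 \<Longrightarrow> h \<bullet> (M *v h) > 0"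
  shows "M ** matrix_inv M = mat 1" "matrix_inv M ** M = mat 1"
proof -
  have "\<forall>h. M *v h = 0 \<longrightarrow> h = 0"
    using assms by (metis inner_zero_right less_irrefl)
  then have "invertible M"
    by (simp add: invertible_left_inverse matrix_left_invertible_ker)
  then have "M ** matrix_inv M = mat 1 \<and> matrix_inv M ** M = mat 1"
    unfolding invertible_def matrix_inv_def by (rule someI_ex)
  then show "M ** matrix_inv M = mat 1" "matrix_inv M ** M = mat 1"
    by auto
qed

lemma positive_definite_Cauchy_Schwarz:
  assumes "positive_definite M"
  shows "\<bar>u \<bullet> (M *v v)\<bar> \<le> sqrt (u \<bullet> (M *v u)) * sqrt (v \<bullet> (M *v v))"
proof (cases "v = 0")
  case False
  define c where "c = v \<bullet> (M *v v)"
  define b where "b = u \<bullet> (M *v v)"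
  define a where "a = u \<bullet> (M *v u)"
  have sym: "v \<bullet> (M *v u) = b"
    using assms unfolding b_def positive_definite_def
    by (metis inner_commute inner_transpose_mult)
  have nonneg: "h \<bullet> (M *v h) \<ge> 0" for h
    using assms unfolding positive_definite_def by (metis inner_zero_left less_eq_real_def)
  have "c > 0"
    using assms False by (simp add: positive_definite_def c_def)
  \<comment> \<open>This vector is \<open>c\<close> times the component of \<open>u\<close>
    orthogonal to \<open>v\<close> in the inner product given by \<open>M\<close>.\<close>
  have "0 \<le> (c *\<^sub>R u - b *\<^sub>R v) \<bullet> (M *v (c *\<^sub>R u - b *\<^sub>R v))"
    by (rule nonneg)
  also have "\<dots> = c * (c * a - b\<^sup>2)"
    by (simp add: matrix_vector_mult_diff_distrib matrix_vector_mult_scaleR inner_diff_left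
        inner_diff_right sym flip: a_def b_def c_def) (simp add: algebra_simps power2_eq_square)
  finally have "b\<^sup>2 \<le> a * c"
    using \<open>c > 0\<close> by (simp add: zero_le_mult_iff mult.commute)
  then have "sqrt (b\<^sup>2) \<le> sqrt (a * c)"
    by (rule real_sqrt_le_mono)
  then show ?thesis
    by (simp add: real_sqrt_mult flip: a_def b_def c_def)
qed simp

section \<open>Cones\<close>

text \<open>The translate of the open set \<open>interior C\<close> by an element of
  \<open>C\<close> is an open subset of \<open>C\<close>; the next lemma argues likewise with a
  dilation.\<close>

lemma convex_cone_interior_add:
  fixes C :: "'a::real_normed_vector set"
  assumes "convex_cone C" "x \<in> interior C" "y \<in> C"
  shows "x + y \<in> interior C"
proof -
  have "(+) y ` interior C \<subseteq> C"
    using assms convex_cone_add interior_subset by blast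
  then have "(+) y ` interior C \<subseteq> interior C"
    by (intro interior_maximal open_translation) auto
  then show ?thesis
    using assms(2) by (auto simp: add.commute)
qed

lemma convex_cone_interior_scaleR:
  fixes C :: "'a::real_normed_vector set"
  assumes "convex_cone C" "x \<in> interior C" "t > 0"
  shows "t *\<^sub>R x \<in> interior C"
proof -
  have "(*\<^sub>R) t ` interior C \<subseteq> C"
    using assms(1,3) interior_subset[of C] by (auto simp: convex_cone_iff)
  then have "(*\<^sub>R) t ` interior C \<subseteq> interior C"
    using assms(3) by (intro interior_maximal open_scaling) auto
  then show ?thesis
    using assms(2) by auto
qed

lemma dual_cone_bipolar:
  fixes K :: "'a::euclidean_space set"
  assumes "convex_cone K" "closed K" and x: "\<And>y. y \<in> dual_cone K \<Longrightarrow> x \<bullet> y \<ge> 0"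
  shows "x \<in> K"
proof (rule ccontr)
  assume "x \<notin> K"
  with assms obtain a c where a: "a \<bullet> x < c" "\<And>z. z \<in> K \<Longrightarrow> a \<bullet> z > c"
    using separating_hyperplane_closed_point[of K x] by (auto simp: convex_cone_def)
  have "c < 0"
    using a(2)[of 0] assms(1) by (simp add: convex_cone_iff)
  have "a \<in> dual_cone K"
    unfolding dual_cone_def
  proof (clarify, rule ccontr)
    fix z assume "z \<in> K" "\<not> 0 \<le> z \<bullet> a"
    \<comment> \<open>Numerator and denominator are both negative, so the factor is positive; it
      moves \<open>z\<close> onto the hyperplane where the inner product with \<open>a\<close> is
      exactly \<open>c\<close>.\<close>
    then have "(c / (z \<bullet> a)) *\<^sub>R z \<in> K"
      using assms(1) \<open>c < 0\<close> by (simp add: convex_cone_iff divide_nonpos_nonpos)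
    from a(2)[OF this] show False
      using \<open>\<not> 0 \<le> z \<bullet> a\<close> by (simp add: inner_commute)
  qed
  from x[OF this] a(1) \<open>c < 0\<close> show False
    by (simp add: inner_commute)
qed

section \<open>Self-concordance along a ray\<close>

text \<open>Self-concordance says that \<open>p'' powr (-1/2)\<close> is 1-Lipschitz, so \<open>p''\<close> cannot decay faster
  than \<open>(r / (1 + r t))\<^sup>2\<close> with \<open>r\<^sup>2 = p'' 0\<close>; the bound follows by integrating twice.\<close>

lemma self_concordant_ray_lower_bound:
  fixes p p' p'' p''' :: "real \<Rightarrow> real"
  assumes p: "\<And>t. t \<ge> 0 \<Longrightarrow> (p has_real_derivative p' t) (at t)"
    and p': "\<And>t. t \<ge> 0 \<Longrightarrow> (p' has_real_derivative p'' t) (at t)"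
    and p'': "\<And>t. t \<ge> 0 \<Longrightarrow> (p'' has_real_derivative p''' t) (at t)"
    and pos: "\<And>t. t \<ge> 0 \<Longrightarrow> p'' t > 0"
    and sc: "\<And>t. t \<ge> 0 \<Longrightarrow> \<bar>p''' t\<bar> \<le> 2 * p'' t powr (3/2)"
    and "t \<ge> 0"
  defines "r \<equiv> sqrt (p'' 0)"
  shows "p t \<ge> p 0 + (p' 0 + r) * t - ln (1 + r * t)"
proof -
  have r: "r > 0"
    using pos[of 0] by (simp add: r_def)
  have low: "p'' t \<ge> (r / (1 + r * t))\<^sup>2" if "t \<ge> 0" for t
  proof -
    \<comment> \<open>Monotone because \<open>p''' \<ge> - 2 * p'' powr (3/2)\<close>: thus
      \<open>p'' powr (-1/2)\<close> grows at rate at most 1 from its initial value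
      \<open>1 / r\<close>.\<close>
    let ?q = "\<lambda>t. t - p'' t powr (-1/2)"
    have "?q 0 \<le> ?q t"
    proof (rule DERIV_nonneg_imp_nondecreasing[OF that])
      fix x :: real assume "0 \<le> x"
      have "p''' x \<ge> - 2 * p'' x powr (3/2)"
        using sc[OF \<open>0 \<le> x\<close>] by linarith
      then have "p'' x powr (-3/2) * p''' x \<ge> p'' x powr (-3/2) * (- 2 * p'' x powr (3/2))"
        by (intro mult_left_mono) auto
      also have "p'' x powr (-3/2) * (- 2 * p'' x powr (3/2)) = -2"
        using pos[OF \<open>0 \<le> x\<close>] by (simp flip: powr_add)
      finally have "1 + 1/2 * p'' x powr (-3/2) * p''' x \<ge> 0"
        by simp
      moreover have "(?q has_real_derivative 1 + 1/2 * p'' x powr (-3/2) * p''' x) (at x)"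
        using pos[OF \<open>0 \<le> x\<close>] by (auto intro!: derivative_eq_intros p'' \<open>0 \<le> x\<close>)
      ultimately show "\<exists>y. (?q has_real_derivative y) (at x) \<and> 0 \<le> y"
        by blast
    qed
    moreover have half: "p'' s powr (-1/2) = 1 / sqrt (p'' s)" if "s \<ge> 0" for s
      using pos[OF that] by (simp add: powr_minus_divide powr_half_sqrt)
    ultimately have "1 / sqrt (p'' t) \<le> (1 + r * t) / r"
      using that r by (simp add: field_simps flip: r_def)
    then have "r / (1 + r * t) \<le> sqrt (p'' t)"
      using r pos[OF that] that by (simp add: field_simps add_pos_nonneg)
    then have "(r / (1 + r * t))\<^sup>2 \<le> (sqrt (p'' t))\<^sup>2"
      using r that by (intro power_mono) auto
    then show ?thesis
      using pos[OF that] by simp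
  qed
  have mid: "p' t \<ge> p' 0 + r - r / (1 + r * t)" if "t \<ge> 0" for t
  proof -
    \<comment> \<open>First integration: \<open>r / (1 + r * t)\<close> has derivative
      \<open>- (r / (1 + r * t))\<^sup>2\<close>.\<close>
    let ?q = "\<lambda>t. p' t + r / (1 + r * t)"
    have "?q 0 \<le> ?q t"
    proof (rule DERIV_nonneg_imp_nondecreasing[OF that])
      fix x :: real assume "0 \<le> x"
      then have "1 + r * x \<noteq> 0"
        using r by (metis add_pos_nonneg less_irrefl mult_nonneg_nonneg less_imp_le zero_less_one)
      then have "(?q has_real_derivative p'' x - (r / (1 + r * x))\<^sup>2) (at x)"
        by (auto intro!: derivative_eq_intros p' \<open>0 \<le> x\<close> simp: power2_eq_square)
      then show "\<exists>y. (?q has_real_derivative y) (at x) \<and> 0 \<le> y"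
        using low[OF \<open>0 \<le> x\<close>] by (intro exI[of _ "p'' x - (r / (1 + r * x))\<^sup>2"]) simp
    qed
    then show ?thesis by simp
  qed
  \<comment> \<open>Second integration: \<open>ln (1 + r * t)\<close> is an antiderivative of
    \<open>r / (1 + r * t)\<close>.\<close>
  let ?q = "\<lambda>t. p t - (p' 0 + r) * t + ln (1 + r * t)"
  have "?q 0 \<le> ?q t"
  proof (rule DERIV_nonneg_imp_nondecreasing[OF \<open>t \<ge> 0\<close>])
    fix x :: real assume "0 \<le> x"
    then have "1 + r * x > 0"
      using r by (simp add: add_pos_nonneg)
    then have "(?q has_real_derivative p' x - (p' 0 + r) + r / (1 + r * x)) (at x)"
      by (auto intro!: derivative_eq_intros p \<open>0 \<le> x\<close>)
    then show "\<exists>y. (?q has_real_derivative y) (at x) \<and> 0 \<le> y"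
      using mid[OF \<open>0 \<le> x\<close>] by (intro exI[of _ "p' x - (p' 0 + r) + r / (1 + r * x)"]) simp
  qed
  then show ?thesis by simp
qed

section \<open>Logarithmically homogeneous barriers\<close>

text \<open>Differentiate the homogeneity identity in \<open>x\<close> with \<open>t\<close> fixed:
  \<open>\<nu> * ln t\<close> is a constant and drops out.\<close>

lemma nu_LHSCB_gradient_scaleR:
  assumes "nu_LHSCB \<nu> C f" "x \<in> interior C" "t > 0"
  shows "t *\<^sub>R gradient f (t *\<^sub>R x) = gradient f x"
proof -
  have C: "convex_cone C" and diff: "\<And>x. x \<in> interior C \<Longrightarrow> f differentiable at x"
    using assms(1) by (auto simp: nu_LHSCB_def SCB_def three_times_differentiable_on_def)
  have tx: "t *\<^sub>R x \<in> interior C"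
    by (rule convex_cone_interior_scaleR) (use C assms in auto)
  have scale: "((\<lambda>x. t *\<^sub>R x) has_derivative (\<lambda>h. t *\<^sub>R h)) (at x)"
    by (auto intro!: derivative_eq_intros)
  have "((\<lambda>x. f (t *\<^sub>R x) + \<nu> * ln t) has_derivative (\<lambda>h. (t *\<^sub>R h) \<bullet> gradient f (t *\<^sub>R x) + 0)) (at x)"
    by (intro has_derivative_add has_derivative_const has_derivative_compose[OF scale]
        GDERIV_gradient[OF diff[OF tx], unfolded gderiv_def])
  then have "(f has_derivative (\<lambda>h. (t *\<^sub>R h) \<bullet> gradient f (t *\<^sub>R x) + 0)) (at x)"
    by (rule has_derivative_transform_within_open[OF _ open_interior assms(2)])
      (use assms in \<open>auto simp: nu_LHSCB_def\<close>)
  then have "GDERIV f x :> t *\<^sub>R gradient f (t *\<^sub>R x)"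
    by (simp add: gderiv_def)
  then show ?thesis
    by (simp add: gradientI)
qed

text \<open>Euler's relation for a gradient homogeneous of degree -1: differentiate the constant map
  \<open>t *\<^sub>R gradient f (t *\<^sub>R x)\<close> in \<open>t\<close> at 1.\<close>

lemma nu_LHSCB_hessian_mult_self:
  assumes "nu_LHSCB \<nu> C f" "x \<in> interior C"
  shows "hessian f x *v x = - gradient f x"
proof -
  have "gradient f differentiable at x"
    using assms by (auto simp: nu_LHSCB_def SCB_def three_times_differentiable_on_def)
  then have g: "(gradient f has_derivative (*v) (hessian f x)) (at (1 *\<^sub>R x))"
    by (simp add: has_derivative_gradient)
  have sx: "((\<lambda>t. t *\<^sub>R x) has_derivative (\<lambda>h. h *\<^sub>R x)) (at 1)"
    by (auto intro!: derivative_eq_intros)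
  have "((\<lambda>t. t *\<^sub>R gradient f (t *\<^sub>R x)) has_derivative
      (\<lambda>h. 1 *\<^sub>R (hessian f x *v (h *\<^sub>R x)) + h *\<^sub>R gradient f (1 *\<^sub>R x))) (at 1)"
    by (intro has_derivative_scaleR has_derivative_ident has_derivative_compose[OF sx g])
  then have "((\<lambda>t. gradient f x) has_derivative
      (\<lambda>h. 1 *\<^sub>R (hessian f x *v (h *\<^sub>R x)) + h *\<^sub>R gradient f (1 *\<^sub>R x))) (at 1)"
    by (rule has_derivative_transform_within_open[where s = "{0<..}"])
      (use assms in \<open>auto simp: nu_LHSCB_gradient_scaleR\<close>)
  from has_derivative_unique[OF this has_derivative_const, THEN fun_cong, of 1]
  show ?thesis
    by (simp add: eq_neg_iff_add_eq_0)
qed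

text \<open>Along the ray \<open>x + t u\<close> logarithmic homogeneity lets \<open>f\<close> grow at most logarithmically, while
  self-concordance makes it grow at the rate \<open>g \<bullet> u + \<parallel>u\<parallel>\<close> up to a logarithm.\<close>

lemma nu_LHSCB_local_norm_le_interior:
  assumes f: "nu_LHSCB \<nu> C f" and x: "x \<in> interior C" and u: "u \<in> interior C"
  shows "sqrt (u \<bullet> (hessian f x *v u)) \<le> - (gradient f x \<bullet> u)"
proof (cases "u = 0")
  case False
  have C: "convex_cone C" and sconv: "strictly_convex_on (interior C) f"
    and diff: "three_times_differentiable_on f (interior C)"
    and pd: "\<And>x. x \<in> interior C \<Longrightarrow> positive_definite (hessian f x)"
    and sc: "\<And>x h. x \<in> interior C \<Longrightarrow>
        \<bar>third_derivative f x h\<bar> \<le> 2 * (h \<bullet> (hessian f x *v h)) powr (3/2)"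
    and hom: "\<And>x t. x \<in> interior C \<Longrightarrow> t > 0 \<Longrightarrow> f (t *\<^sub>R x) = f x - \<nu> * ln t"
    using f by (auto simp: nu_LHSCB_def SCB_def)
  have ray: "x + t *\<^sub>R u \<in> interior C" if "t \<ge> 0" for t
    by (rule convex_cone_interior_add)
      (use C x u that interior_subset[of C] in \<open>auto simp: convex_cone_iff\<close>)
  define p where "p t = f (x + t *\<^sub>R u)" for t
  define p1 where "p1 t = u \<bullet> gradient f (x + t *\<^sub>R u)" for t
  define p2 where "p2 t = u \<bullet> (hessian f (x + t *\<^sub>R u) *v u)" for t
  define p3 where "p3 t = third_derivative f (x + t *\<^sub>R u) u" for t
  define r where "r = sqrt (p2 0)"
  have line: "((\<lambda>t. x + t *\<^sub>R u) has_derivative (\<lambda>h. h *\<^sub>R u)) (at t)" for t :: real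
    by (auto intro!: derivative_eq_intros)
  have low: "p t \<ge> p 0 + (p1 0 + r) * t - ln (1 + r * t)" if "t \<ge> 0" for t
    unfolding r_def
  proof (rule self_concordant_ray_lower_bound[where p = p and p' = p1 and p'' = p2 and p''' = p3])
    fix t :: real assume t: "t \<ge> 0"
    note d = diff[unfolded three_times_differentiable_on_def, rule_format, OF ray[OF t]]
    have "(p has_derivative (\<lambda>h. (h *\<^sub>R u) \<bullet> gradient f (x + t *\<^sub>R u))) (at t)"
      unfolding p_def
      by (rule has_derivative_compose[OF line GDERIV_gradient[unfolded gderiv_def]]) (use d in auto)
    then show "(p has_real_derivative p1 t) (at t)"
      by (simp add: has_field_derivative_def p1_def mult.commute[of _ "u \<bullet> _"])
    have "(p1 has_derivative (\<lambda>h. u \<bullet> (hessian f (x + t *\<^sub>R u) *v (h *\<^sub>R u)))) (at t)"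
      unfolding p1_def
      by (intro has_derivative_inner_right has_derivative_compose[OF line has_derivative_gradient])
        (use d in auto)
    then show "(p1 has_real_derivative p2 t) (at t)"
      by (simp add: has_field_derivative_def p2_def matrix_vector_mult_scaleR
          mult.commute[of _ "u \<bullet> _"])
    let ?D = "frechet_derivative (hessian f) (at (x + t *\<^sub>R u))"
    have D: "(hessian f has_derivative ?D) (at (x + t *\<^sub>R u))"
      using d by (simp add: frechet_derivative_works)
    have bl: "bounded_linear (\<lambda>M. u \<bullet> (M *v u))"
      by (auto intro!: linearI simp: linear_conv_bounded_linear[symmetric]
          matrix_vector_mult_add_rdistrib inner_add_right scaleR_matrix_vector_assoc[symmetric])
    have "(p2 has_derivative (\<lambda>h. u \<bullet> (?D (h *\<^sub>R u) *v u))) (at t)"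
      unfolding p2_def
      by (rule bounded_linear.has_derivative[OF bl has_derivative_compose[OF line D]])
    then show "(p2 has_real_derivative p3 t) (at t)"
      by (simp add: has_field_derivative_def p3_def third_derivative_def
          linear_scale[OF has_derivative_linear[OF D]] scaleR_matrix_vector_assoc[symmetric]
          mult.commute[of _ "u \<bullet> _"])
    show "p2 t > 0"
      using pd[OF ray[OF t]] False by (simp add: p2_def positive_definite_def)
    show "\<bar>p3 t\<bar> \<le> 2 * p2 t powr (3/2)"
      using sc[OF ray[OF t]] by (simp add: p2_def p3_def)
  qed (fact that)
  \<comment> \<open>The ray point is \<open>1 + t\<close> times a point \<open>z\<close> of the
    segment from \<open>x\<close> to \<open>u\<close>. Convexity bounds \<open>f z\<close>, and
    homogeneity accounts for the factor. The coefficient \<open>\<bar>\<nu>\<bar> + 1\<close>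
    dominates \<open>- \<nu>\<close> and is certainly positive.\<close>
  have up: "p t \<le> \<bar>f x\<bar> + \<bar>f u\<bar> + (\<bar>\<nu>\<bar> + 1) * ln (1 + t)" if "t > 0" for t
  proof -
    define z where "z = (1 - t / (1 + t)) *\<^sub>R x + (t / (1 + t)) *\<^sub>R u"
    have s: "0 < t / (1 + t)" "t / (1 + t) < 1"
      using that by auto
    have "x + t *\<^sub>R u = (1 + t) *\<^sub>R z"
      using that by (simp add: z_def scaleR_add_right) (simp add: field_simps)
    moreover have "z \<in> interior C"
      unfolding z_def using s
      by (intro convexD convex_interior x u) (use C in \<open>auto simp: convex_cone_def\<close>)
    ultimately have "p t = f z - \<nu> * ln (1 + t)"
      using that hom by (simp add: p_def)
    moreover have "f z \<le> \<bar>f x\<bar> + \<bar>f u\<bar>"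
    proof (cases "x = u")
      case True
      then have "z = x"
        unfolding z_def by (metis diff_add_cancel scaleR_left_distrib scaleR_one)
      then show ?thesis by simp
    next
      case False
      with s x u sconv have "f z < (1 - t / (1 + t)) * f x + t / (1 + t) * f u"
        unfolding z_def strictly_convex_on_def by blast
      moreover have "a * c \<le> \<bar>c\<bar>" if "0 \<le> a" "a \<le> 1" for a c :: real
        using that abs_ge_self[of "a * c"] mult_left_le_one_le[of "\<bar>c\<bar>" a] by (simp add: abs_mult)
      from this[of "1 - t / (1 + t)" "f x"] this[of "t / (1 + t)" "f u"]
      have "(1 - t / (1 + t)) * f x \<le> \<bar>f x\<bar>" "t / (1 + t) * f u \<le> \<bar>f u\<bar>"
        using s by auto
      ultimately show ?thesis by linarith
    qed
    moreover have "- \<nu> * ln (1 + t) \<le> (\<bar>\<nu>\<bar> + 1) * ln (1 + t)"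
      using that by (intro mult_right_mono) auto
    ultimately show ?thesis by simp
  qed
  have "r > 0"
    using pd[OF x] False by (simp add: r_def p2_def positive_definite_def)
  \<comment> \<open>A positive slope would make the lower bound \<open>low\<close> outgrow the
    logarithmic bound \<open>up\<close>.\<close>
  have "p1 0 + r \<le> 0"
  proof (rule ccontr)
    define c m where "c = p1 0 + r" and "m = \<bar>\<nu>\<bar> + 1"
    assume "\<not> p1 0 + r \<le> 0"
    then have "c > 0" "m > 0"
      by (auto simp: c_def m_def)
    then have "filterlim (\<lambda>t. c * t - ln (1 + r * t) - m * ln (1 + t)) at_top at_top"
      using \<open>r > 0\<close> by real_asymp
    \<comment> \<open>One \<open>\<bar>f x\<bar>\<close> comes from \<open>up\<close>, the other
      from bounding \<open>p 0\<close> below.\<close>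
    then have "eventually (\<lambda>t. c * t - ln (1 + r * t) - m * ln (1 + t) > 2 * \<bar>f x\<bar> + \<bar>f u\<bar>) at_top"
      by (simp add: filterlim_at_top_dense)
    then obtain t where "t > 0" "c * t - ln (1 + r * t) - m * ln (1 + t) > 2 * \<bar>f x\<bar> + \<bar>f u\<bar>"
      using eventually_happens[OF eventually_conj[OF _ eventually_gt_at_top[of 0]]] by force
    moreover have "p 0 \<ge> - \<bar>f x\<bar>"
      by (simp add: p_def)
    ultimately show False
      using low[of t] up[of t] by (simp add: c_def m_def)
  qed
  then show ?thesis
    by (simp add: p1_def p2_def r_def inner_commute)
qed simp

text \<open>Both sides are continuous in \<open>u\<close>, and a convex set with non-empty interior
  lies in the closure of that interior.\<close>

lemma nu_LHSCB_local_norm_le: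
  assumes f: "nu_LHSCB \<nu> C f" and x: "x \<in> interior C" and u: "u \<in> C"
  shows "sqrt (u \<bullet> (hessian f x *v u)) \<le> - (gradient f x \<bullet> u)"
proof -
  have "convex C" "interior C \<noteq> {}"
    using f by (auto simp: nu_LHSCB_def SCB_def convex_cone_def)
  then have "u \<in> closure (interior C)"
    using u closure_subset by (auto simp: convex_closure_interior)
  moreover have "continuous_on (closure (interior C))
      (\<lambda>u. sqrt (u \<bullet> (hessian f x *v u)) + gradient f x \<bullet> u)"
    by (intro continuous_intros matrix_vector_mult_linear_continuous_on)
  moreover have "sqrt (w \<bullet> (hessian f x *v w)) + gradient f x \<bullet> w \<le> 0" if "w \<in> interior C" for w
    using nu_LHSCB_local_norm_le_interior[OF f x that] by simp
  ultimately have "sqrt (u \<bullet> (hessian f x *v u)) + gradient f x \<bullet> u \<le> 0"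
    using continuous_le_on_closure by blast
  then show ?thesis by simp
qed

text \<open>The rank-one term contributes the product of \<open>- (gradient f x \<bullet> u)\<close>
  and \<open>- (gradient f x \<bullet> v)\<close>, which is at least the product of the local norms;
  by Cauchy-Schwarz the Hessian term is at least minus that product.\<close>

lemma nu_LHSCB_B_matrix_nonneg:
  assumes f: "nu_LHSCB \<nu> C f" and x: "x \<in> interior C" and u: "u \<in> C" and v: "v \<in> C"
  shows "u \<bullet> (B_matrix f x *v v) \<ge> 0"
proof -
  let ?n = "\<lambda>u. sqrt (u \<bullet> (hessian f x *v u))"
  have pd: "positive_definite (hessian f x)"
    using f x by (auto simp: nu_LHSCB_def SCB_def)
  then have n: "?n w \<ge> 0" for w
    unfolding positive_definite_def
    by (metis inner_zero_left less_eq_real_def real_sqrt_ge_zero)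
  have "?n u * ?n v \<le> (- (gradient f x \<bullet> u)) * (- (gradient f x \<bullet> v))"
    using nu_LHSCB_local_norm_le[OF f x u] nu_LHSCB_local_norm_le[OF f x v]
      order_trans[OF n nu_LHSCB_local_norm_le[OF f x u]] n[of v]
    by (intro mult_mono)
  with positive_definite_Cauchy_Schwarz[OF pd, of u v] show ?thesis
    by (simp add: B_matrix_mult inner_add_right inner_commute mult.commute)
qed

section \<open>Linear images of cones\<close>

text \<open>\<open>transpose A *v z\<close> is the combination of the rows of \<open>A\<close> with
  coefficients \<open>z\<close>. This injectivity makes \<open>A ** H ** transpose A\<close>
  positive definite.\<close>

lemma inj_transpose_of_lin_indep_rows:
  assumes "lin_indep_rows A" "transpose A *v z = 0"
  shows "z = 0"
proof -
  have "(\<Sum>i\<in>UNIV. z $ i *s row i A) = 0"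
    using assms(2) by (simp add: matrix_mult_sum column_transpose)
  then show ?thesis
    using assms(1) unfolding lin_indep_rows_def by (metis vec_eq_iff zero_index)
qed

lemma dual_cone_image:
  fixes A :: "real^'n^'m"
  shows "dual_cone ((*v) A ` K) = {y. transpose A *v y \<in> dual_cone K}"
  by (simp add: dual_cone_def inner_transpose_mult)

text \<open>Continuity of \<open>transpose A\<close> gives the converse inclusion; this one rests on
  the point \<open>y0\<close>. For small \<open>e > 0\<close>, \<open>y - e *\<^sub>R y0\<close>
  stays in the dual of the image, so \<open>transpose A *v y\<close> is an interior point of
  \<open>dual_cone K\<close> plus an element of it.\<close>

lemma interior_dual_cone_image:
  fixes A :: "real^'n^'m"
  assumes "convex_cone (dual_cone K)"
    and y0: "transpose A *v y0 \<in> interior (dual_cone K)"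
    and y: "y \<in> interior (dual_cone ((*v) A ` K))"
  shows "transpose A *v y \<in> interior (dual_cone K)"
proof -
  have "((\<lambda>e. y - e *\<^sub>R y0) \<longlongrightarrow> y - 0 *\<^sub>R y0) (at_right 0)"
    by (intro tendsto_intros)
  then have "eventually (\<lambda>e. y - e *\<^sub>R y0 \<in> interior (dual_cone ((*v) A ` K))) (at_right (0::real))"
    by (rule topological_tendstoD) (use y in auto)
  then obtain e :: real where e: "e > 0" "y - e *\<^sub>R y0 \<in> interior (dual_cone ((*v) A ` K))"
    using eventually_happens[OF eventually_conj[OF _ eventually_at_right_less[of 0]]]
    by force
  then have "transpose A *v (y - e *\<^sub>R y0) \<in> dual_cone K"
    using interior_subset[of "dual_cone ((*v) A ` K)"] by (auto simp: dual_cone_image)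
  with convex_cone_interior_scaleR[OF assms(1) y0 e(1)]
  have "e *\<^sub>R (transpose A *v y0) + transpose A *v (y - e *\<^sub>R y0) \<in> interior (dual_cone K)"
    by (intro convex_cone_interior_add assms(1))
  then show ?thesis
    by (simp add: matrix_vector_mult_diff_distrib matrix_vector_mult_scaleR)
qed

theorem theorem3p2:
  fixes K :: "(real^'n) set" and f :: "real^'n \<Rightarrow> real"
    and A :: "real^'n^'m" and b y :: "real^'m"
  assumes "proper_cone K"
    and "LHSCB (dual_cone K) f"
    and "lin_indep_rows A"
    and "{y. transpose A *v y \<in> interior (dual_cone K)} \<noteq> {}"
    and "b \<in> interior ((*v) A ` K)"
    and "B_certificate (dual_cone ((*v) A ` K)) (\<lambda>y. f (transpose A *v y)) b y"
  shows "let H = hessian f (transpose A *v y);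
             x = (H ** transpose A ** matrix_inv (A ** H ** transpose A)) *v b
         in A *v x = b \<and> x \<in> K"
proof -
  define F where "F = (\<lambda>y. f (transpose A *v y))"
  define s where "s = transpose A *v y"
  define H where "H = hessian f s"
  define g where "g = gradient f s"
  define HA where "HA = A ** H ** transpose A"
  define w where "w = matrix_inv (B_matrix F y) *v b"
  define v where "v = transpose A *v w"
  obtain \<nu> where f: "nu_LHSCB \<nu> (dual_cone K) f"
    using assms(2) by (auto simp: LHSCB_def)
  then have D: "convex_cone (dual_cone K)"
    and diff: "three_times_differentiable_on f (interior (dual_cone K))"
    by (auto simp: nu_LHSCB_def SCB_def)
  have s: "s \<in> interior (dual_cone K)"
    using assms(4,6) D interior_dual_cone_image by (auto simp: s_def B_certificate_def)
  have pd: "positive_definite H"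
    using f s by (auto simp: H_def nu_LHSCB_def SCB_def)
  have v: "v \<in> dual_cone K"
    using assms(6) by (auto simp: B_certificate_def dual_cone_image v_def w_def F_def)
  note d = diff[unfolded three_times_differentiable_on_def, rule_format]
  have gradF: "gradient F y = A *v g"
    unfolding F_def g_def s_def
    by (rule gradient_compose_transpose) (use d[OF s] in \<open>auto simp: s_def\<close>)
  have hessF: "hessian F y = HA"
    unfolding F_def HA_def H_def s_def
    by (rule hessian_compose_transpose[OF open_interior s[unfolded s_def]])
      (use d d[OF s] in \<open>auto simp: s_def\<close>)
  have HA_pos: "h \<bullet> (HA *v h) > 0" if "h \<noteq> 0" for h
  proof -
    have "transpose A *v h \<noteq> 0"
      using inj_transpose_of_lin_indep_rows[OF assms(3)] that by blast
    then have "(transpose A *v h) \<bullet> (H *v (transpose A *v h)) > 0"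
      using pd by (simp add: positive_definite_def)
    then show ?thesis
      by (metis HA_def inner_transpose_mult matrix_vector_mul_assoc transpose_transpose)
  qed
  note HA_inv = matrix_inv_of_inner_pos[OF HA_pos]
  \<comment> \<open>Adding the rank-one square keeps the form positive, so \<open>matrix_inv\<close>
    is a true inverse and \<open>w\<close> solves the system with right-hand side
    \<open>b\<close>.\<close>
  have "h \<bullet> (B_matrix F y *v h) > 0" if "h \<noteq> 0" for h
    using HA_pos[OF that]
    by (simp add: B_matrix_mult gradF hessF inner_add_right inner_commute add_pos_nonneg)
  then have "B_matrix F y *v w = b"
    by (simp add: w_def matrix_vector_mul_assoc matrix_inv_of_inner_pos)
  then have b: "b = HA *v w + (g \<bullet> v) *\<^sub>R (A *v g)"
    unfolding v_def by (simp add: B_matrix_mult gradF hessF inner_transpose_mult)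
  have Hs: "H *v s = - g"
    unfolding H_def g_def by (rule nu_LHSCB_hessian_mult_self[OF f s])
  \<comment> \<open>Euler's relation for \<open>f\<close> at \<open>s\<close>, multiplied by
    \<open>A\<close>, is the one for \<open>F\<close> at \<open>y\<close>.\<close>
  have "HA *v y = - (A *v g)"
    using Hs unfolding HA_def s_def
    by (metis matrix_vector_mul_assoc vec.neg)
  then have "matrix_inv HA *v (A *v g) = - y"
    by (metis HA_inv(2) matrix_vector_mul_assoc matrix_vector_mul_lid vec.neg minus_minus)
  then have "matrix_inv HA *v b = w - (g \<bullet> v) *\<^sub>R y"
    unfolding b
    by (simp add: matrix_vector_right_distrib matrix_vector_mult_scaleR matrix_vector_mul_assoc HA_inv)
  \<comment> \<open>Applying \<open>H ** transpose A\<close> to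
    \<open>w - (g \<bullet> v) *\<^sub>R y\<close> gives
    \<open>H *v v - (g \<bullet> v) *\<^sub>R (H *v s)\<close>, and \<open>H *v s = - g\<close>
    turns the second term into the rank-one part.\<close>
  then have x: "(H ** transpose A ** matrix_inv HA) *v b = B_matrix f s *v v"
    using Hs
    by (simp add: B_matrix_mult matrix_vector_mul_assoc[symmetric] matrix_vector_mult_diff_distrib
        matrix_vector_mult_scaleR flip: s_def v_def H_def g_def)
  have "A *v ((H ** transpose A ** matrix_inv HA) *v b) = (HA ** matrix_inv HA) *v b"
    by (simp add: HA_def matrix_vector_mul_assoc matrix_mul_assoc)
  then have "A *v ((H ** transpose A ** matrix_inv HA) *v b) = b"
    by (simp add: HA_inv)
  \<comment> \<open>The certificate enters here: \<open>v\<close> lies in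
    \<open>dual_cone K\<close>, so this vector pairs non-negatively with all of
    \<open>dual_cone K\<close>.\<close>
  moreover have "B_matrix f s *v v \<in> K"
    by (rule dual_cone_bipolar)
      (use assms(1) nu_LHSCB_B_matrix_nonneg[OF f s _ v] in
        \<open>auto simp: proper_cone_def inner_commute\<close>)
  ultimately show ?thesis
    using x by (simp add: Let_def H_def HA_def s_def)
qed

end
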